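(* Let $(X,p,E)$ be a lattice-normed Riesz space, let $(x_n)$ be a sequence in $X$ and let $x\in X$. Then $(x_n)$ is statistically unbounded $p$-convergent to $x$ if and only if there is a sequence $(y_n)$ in $X$ such that $x_n=y_n$ for almost all $n$ and $(y_n)$ is statistically unbounded $p$-convergent to $x$.
   Context: All Riesz spaces (vector lattices) are real and Archimedean; sequences are indexed by the positive integers $\mathbb{N}$; $E_+$ and $X_+$ denote positive cones. A lattice-normed Riesz space $(X,p,E)$ consists of Riesz spaces $X$ and $E$ and a map $p:X\to E_+$ with $p(x)=0\Leftrightarrow x=0$, $p(\lambda x)=|\lambda|p(x)$ for $\lambda\in\mathbb{R}$, $p(x+y)\le p(x)+p(y)$, which is monotone: $|x|\le|y|$ implies $p(x)\le p(y)$. The natural density of $K\subseteq\mathbb{N}$ is $\delta(K)=\lim_{n}\frac1n|\{k\le n:k\in K\}|$. A property holds for almost all $n$ if it holds for all $n\in\mathbb{N}$ outside a set of natural density zero. A sequence $(q_n)$ in $E$ is statistically order decreasing to $0$, written $q_n\downarrow^{st}0$, if there is $K\subseteq\mathbb{N}$ with $\delta(K)=1$ such that $(q_k)_{k\in K}$ is decreasing and $\inf_{k\in K}q_k=0$. A sequence $(x_n)$ in $X$ is statistically unbounded $p$-convergent ($st$-$up$-convergent) to $x\in X$ if for every $u\in X_+$ there exist a sequence $q_n\downarrow^{st}0$ in $E$ and a set $K\subseteq\mathbb{N}$ with $\delta(K)=1$ such that $p(|x_k-x|\wedge u)\le q_k$ for all $k\in K$. *)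

theory Defs
  imports Complex_Main "HOL-Library.Lattice_Algebras" "HOL-Library.Lub_Glb"
begin

class archimedean_riesz_space = ordered_real_vector + lattice_ab_group_add_abs +
  assumes archimedean: "0 \<le> x \<Longrightarrow> 0 \<le> y \<Longrightarrow> (\<And>n::nat. real n *\<^sub>R x \<le> y) \<Longrightarrow> x = 0"

locale lattice_normed_riesz_space =
  fixes p :: "'a::archimedean_riesz_space \<Rightarrow> 'b::archimedean_riesz_space"
  assumes norm_nonneg: "0 \<le> p x"
    and norm_eq_zero_iff: "p x = 0 \<longleftrightarrow> x = 0"
    and norm_scaleR: "p (c *\<^sub>R x) = \<bar>c\<bar> *\<^sub>R p x"
    and norm_triangle: "p (x + y) \<le> p x + p y"
    and norm_mono: "\<bar>x\<bar> \<le> \<bar>y\<bar> \<Longrightarrow> p x \<le> p y"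

text \<open>
  Sequences are functions on \<^typ>\<open>nat\<close> of which only the values at the positive integers
  matter: every index set below is a subset of \<open>{1..}\<close>, and the value at \<open>0\<close> is ignored.
\<close>

definition has_natural_density :: "nat set \<Rightarrow> real \<Rightarrow> bool" where
  "has_natural_density K d \<longleftrightarrow>
     (\<lambda>n. real (card {k \<in> {1..n}. k \<in> K}) / real n) \<longlonglongrightarrow> d"

definition for_almost_all :: "(nat \<Rightarrow> bool) \<Rightarrow> bool" where
  "for_almost_all P \<longleftrightarrow>
     (\<exists>A \<subseteq> {1..}. has_natural_density A 0 \<and> (\<forall>n \<in> {1..} - A. P n))"

definition st_order_decreasing_to_zero :: "(nat \<Rightarrow> 'b::archimedean_riesz_space) \<Rightarrow> bool" where
  "st_order_decreasing_to_zero q \<longleftrightarrow>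
     (\<exists>K \<subseteq> {1..}. has_natural_density K 1 \<and> antimono_on K q \<and> isGlb UNIV (q ` K) 0)"

definition st_up_convergent ::
  "('a::archimedean_riesz_space \<Rightarrow> 'b::archimedean_riesz_space) \<Rightarrow> (nat \<Rightarrow> 'a) \<Rightarrow> 'a \<Rightarrow> bool" where
  "st_up_convergent p x l \<longleftrightarrow>
     (\<forall>u\<ge>0. \<exists>q K. st_order_decreasing_to_zero q \<and> K \<subseteq> {1..} \<and> has_natural_density K 1 \<and>
        (\<forall>k\<in>K. p (inf \<bar>x k - l\<bar> u) \<le> q k))"

end

theory Submission
  imports Defs
begin

text \<open>Statistical convergence constrains the terms only on an index set of density 1, and such
  a set keeps density 1 when a null set is removed (\<open>has_natural_density_Diff_null\<close>).
  Hence changing a sequence on a null set does not affect convergence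
  (\<open>st_up_convergent_almost_all_cong\<close>), which is the backward direction. The forward
  direction takes the sequence itself as \<open>y\<close>, with empty exceptional set.\<close>

lemma has_natural_density_empty: "has_natural_density {} 0"
  by (simp add: has_natural_density_def)

text \<open>\<open>K\<close> is covered by \<open>K - A\<close> and \<open>A\<close>, so the
  counting ratio of \<open>K - A\<close> is squeezed between the ratio of \<open>K\<close> minus
  that of \<open>A\<close> and the ratio of \<open>K\<close>. Both bounds tend to
  \<open>d\<close>.\<close>

lemma has_natural_density_Diff_null:
  assumes "has_natural_density K d" and "has_natural_density A 0"
  shows "has_natural_density (K - A) d"
proof -
  let ?c = "\<lambda>S n. real (card {k \<in> {1..n}. k \<in> S}) / real n"
  have "card {k \<in> {1..n}. k \<in> K} \<le> card ({k \<in> {1..n}. k \<in> K - A} \<union> {k \<in> {1..n}. k \<in> A})" for n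
    by (intro card_mono) auto
  then have "card {k \<in> {1..n}. k \<in> K} \<le>
      card {k \<in> {1..n}. k \<in> K - A} + card {k \<in> {1..n}. k \<in> A}" for n
    by (rule order_trans [OF _ card_Un_le])
  then have "real (card {k \<in> {1..n}. k \<in> K}) \<le>
      real (card {k \<in> {1..n}. k \<in> K - A}) + real (card {k \<in> {1..n}. k \<in> A})" for n
    by (simp only: of_nat_add [symmetric] of_nat_le_iff)
  \<comment> \<open>The case \<open>n = 0\<close> needs no exception: division by 0 yields 0, and
    \<open>divide_right_mono\<close> asks only for a nonnegative divisor.\<close>
  then have lower: "?c K n - ?c A n \<le> ?c (K - A) n" for n
    unfolding diff_le_eq add_divide_distrib [symmetric] by (rule divide_right_mono) simp
  have upper: "?c (K - A) n \<le> ?c K n" for n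
    by (rule divide_right_mono) (auto intro!: card_mono)
  have "(\<lambda>n. ?c K n - ?c A n) \<longlonglongrightarrow> d - 0"
    using assms unfolding has_natural_density_def by (intro tendsto_diff)
  then have "(\<lambda>n. ?c K n - ?c A n) \<longlonglongrightarrow> d"
    by simp
  \<comment> \<open>The rotation puts the two limit premises first, so that the chained facts
    determine the bounding sequences.\<close>
  then have "?c (K - A) \<longlonglongrightarrow> d"
    using assms(1) unfolding has_natural_density_def
    by (rule tendsto_sandwich [rotated 2]) (intro always_eventually allI lower upper)+
  then show ?thesis
    by (simp add: has_natural_density_def)
qed

lemma st_up_convergent_almost_all_cong:
  assumes eq: "for_almost_all (\<lambda>n. x n = y n)" and y: "st_up_convergent p y l"
  shows "st_up_convergent p x l"
  unfolding st_up_convergent_def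
proof (intro allI impI)
  fix u :: 'a assume "0 \<le> u"
  then obtain q K where q: "st_order_decreasing_to_zero q"
    and K: "K \<subseteq> {1..}" "has_natural_density K 1" "\<forall>k\<in>K. p (inf \<bar>y k - l\<bar> u) \<le> q k"
    using y unfolding st_up_convergent_def by blast
  obtain A where A: "has_natural_density A 0" "\<forall>n \<in> {1..} - A. x n = y n"
    using eq unfolding for_almost_all_def by blast
  \<comment> \<open>The same \<open>q\<close> serves for \<open>x\<close>; only the set on which it
    dominates shrinks, not the set along which it decreases to 0. The null set \<open>A\<close> is
    the same for every \<open>u\<close>.\<close>
  have "\<forall>k\<in>K - A. p (inf \<bar>x k - l\<bar> u) \<le> q k"
    using K A(2) by fastforce
  then show "\<exists>q K. st_order_decreasing_to_zero q \<and> K \<subseteq> {1..} \<and> has_natural_density K 1 \<and>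
      (\<forall>k\<in>K. p (inf \<bar>x k - l\<bar> u) \<le> q k)"
    using q K(1) has_natural_density_Diff_null[OF K(2) A(1)] by blast
qed

theorem theorem4p1:
  fixes p :: "'a::archimedean_riesz_space \<Rightarrow> 'b::archimedean_riesz_space"
    and x :: "nat \<Rightarrow> 'a" and l :: 'a
  assumes "lattice_normed_riesz_space p"
  shows "st_up_convergent p x l \<longleftrightarrow>
    (\<exists>y :: nat \<Rightarrow> 'a. for_almost_all (\<lambda>n. x n = y n) \<and> st_up_convergent p y l)"
proof -
  have "for_almost_all (\<lambda>n. x n = x n)"
    unfolding for_almost_all_def using has_natural_density_empty by blast
  then show ?thesis
    using st_up_convergent_almost_all_cong by blast
qed

end
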